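(* Let $X_1,\dots,X_n$ be dependent random variables sharing an Archimedean copula with generator $\psi_1$, with $X_i\sim LS(\lambda,\sigma_i,F)$, $i=1,\dots,n$. Let $Y_1,\dots,Y_n$ be dependent random variables sharing an Archimedean copula with generator $\psi_2$, with $Y_i\sim LS(\lambda,\xi_i,G)$, $i=1,\dots,n$. Assume that $\boldsymbol{\lambda},\boldsymbol{\sigma},\boldsymbol{\xi}$ all belong to $\mathcal{D}_+$ (or all belong to $\mathcal{E}_+$), where $\boldsymbol{\lambda}=(\lambda,\dots,\lambda)$. Suppose that $\phi_2\circ\psi_1$ is super-additive, that $\psi_1$ or $\psi_2$ is log-convex, and that $X\geq_{st}Y$. If either $\tilde r_X(u)$ or $\tilde r_Y(u)$ is decreasing in $u$, then $$\tfrac{1}{\boldsymbol{\sigma}}\stackrel{w}{\succeq}\tfrac{1}{\boldsymbol{\xi}}\quad\Longrightarrow\quad X_{n:n}\geq_{st}Y_{n:n}.$$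
   Context: Location-scale family: a random variable follows $LS(\lambda,\sigma,F)$, $\lambda\in\mathbb{R}$, $\sigma>0$, if its distribution function is $x\mapsto F\left(\frac{x-\lambda}{\sigma}\right)$ for $x>\lambda$, where $F$ is a baseline distribution function (so only arguments $u>0$ of the baseline functions matter). $X$ and $Y$ are absolutely continuous random variables with distribution functions $F$ and $G$ and densities $f$ and $g$; their reversed hazard rates are $\tilde r_X=f/F$ and $\tilde r_Y=g/G$. $\boldsymbol{\sigma}=(\sigma_1,\dots,\sigma_n)$, $\boldsymbol{\xi}=(\xi_1,\dots,\xi_n)$, and $\frac1{\boldsymbol{\sigma}}=(1/\sigma_1,\dots,1/\sigma_n)$, similarly $\frac1{\boldsymbol{\xi}}$. Copulas: a generator is $\psi:[0,\infty]\to[0,1]$ with $\psi(0)=1$, $\psi(\infty)=0$ that is $n$-monotone, i.e. $(-1)^k\psi^{(k)}\ge 0$ for $k=0,\dots,n-2$ and $(-1)^{n-2}\psi^{(n-2)}$ is decreasing and convex; the Archimedean copula is $C_\psi(u_1,\dots,u_n)=\psi\left(\sum_{k=1}^n\psi^{-1}(u_k)\right)$. Write $\phi_i=\psi_i^{-1}$ (right-continuous inverse). The $X_k$ have joint distribution function $P(X_1\le x_1,\dots,X_n\le x_n)=\psi_1\left(\sum_k\phi_1(P(X_k\le x_k))\right)$, and similarly for the $Y_k$ with $\psi_2,\phi_2$; thus for $t>\lambda$ the distribution function of $X_{n:n}$ is $\psi_1\left[\sum_{k=1}^n\phi_1\left\{F\left(\frac{t-\lambda}{\sigma_k}\right)\right\}\right]$.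 A function $f$ is super-additive if $f(x+y)\ge f(x)+f(y)$ for all $x,y$ in its domain. $X_{n:n}=\max_i X_i$, $Y_{n:n}=\max_i Y_i$. $U\geq_{st}V$ means $P(U\le t)\le P(V\le t)$ for all $t$. $\mathcal{D}_+=\{\mathbf{x}: x_1\ge x_2\ge\dots\ge x_n>0\}$, $\mathcal{E}_+=\{\mathbf{x}: 0<x_1\le x_2\le\dots\le x_n\}$. With $x_{(1)}\le\dots\le x_{(n)}$ the increasing arrangement, $\mathbf{x}\stackrel{w}{\succeq}\mathbf{y}$ means $\sum_{i=1}^j x_{(i)}\le\sum_{i=1}^j y_{(i)}$ for $j=1,\dots,n$. *)

theory Defs
  imports "HOL-Probability.Probability"
begin

text \<open>Vectors of length \<open>n\<close> are functions on \<^typ>\<open>nat\<close>, of which only the entries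
  \<open>1, ..., n\<close> are used.\<close>

definition dist_fun :: "'a measure \<Rightarrow> ('a \<Rightarrow> real) \<Rightarrow> real \<Rightarrow> real" where
  "dist_fun M U = cdf (distr M borel U)"

definition st_ge :: "'a measure \<Rightarrow> ('a \<Rightarrow> real) \<Rightarrow> 'b measure \<Rightarrow> ('b \<Rightarrow> real) \<Rightarrow> bool" where
  "st_ge M U N V \<longleftrightarrow> (\<forall>t. dist_fun M U t \<le> dist_fun N V t)"

definition rev_hazard :: "(real \<Rightarrow> real) \<Rightarrow> (real \<Rightarrow> real) \<Rightarrow> real \<Rightarrow> real" where
  "rev_hazard f F u = f u / F u"

text \<open>The reversed hazard rate \<open>f / F\<close> is undefined where \<open>F\<close> vanishes (where Isabelle's
  division would return 0), so monotonicity is only required where \<open>F > 0\<close>; arguments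
  \<open>u \<le> 0\<close> are irrelevant for the location-scale family.\<close>

definition decreasing_rev_hazard :: "(real \<Rightarrow> real) \<Rightarrow> (real \<Rightarrow> real) \<Rightarrow> bool" where
  "decreasing_rev_hazard f F \<longleftrightarrow> antimono_on {u. 0 < u \<and> 0 < F u} (rev_hazard f F)"

definition max_order_stat :: "nat \<Rightarrow> (nat \<Rightarrow> 'a \<Rightarrow> real) \<Rightarrow> 'a \<Rightarrow> real" where
  "max_order_stat n X \<omega> = Max ((\<lambda>i. X i \<omega>) ` {1..n})"

text \<open>The distribution function is \<open>x \<mapsto> F ((x - l) / s)\<close> for \<open>x > l\<close>, and there is no mass
  below \<open>l\<close>.  The value at \<open>l\<close> itself is \<open>F 0\<close> by right-continuity, so nothing forces
  \<open>F 0 = 0\<close>.\<close>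

definition loc_scale ::
  "'a measure \<Rightarrow> real \<Rightarrow> real \<Rightarrow> (real \<Rightarrow> real) \<Rightarrow> ('a \<Rightarrow> real) \<Rightarrow> bool" where
  "loc_scale M l s F U \<longleftrightarrow>
     0 < s \<and> U \<in> borel_measurable M \<and>
     (\<forall>x>l. dist_fun M U x = F ((x - l) / s)) \<and>
     (\<forall>x<l. dist_fun M U x = 0)"

text \<open>Derivatives are taken on the open half-line: for instance the Gumbel generators have no
  finite derivative at 0.  For \<open>n = 1\<close>, where there is no genuine copula, the truncated
  \<open>n - 2\<close> makes this the case \<open>n = 2\<close>.\<close>

definition n_monotone :: "nat \<Rightarrow> (real \<Rightarrow> real) \<Rightarrow> bool" where
  "n_monotone n f \<longleftrightarrow>
     (\<forall>k < n - 2. \<forall>x>0. (deriv ^^ k) f field_differentiable at x) \<and>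
     (\<forall>k \<le> n - 2. \<forall>x>0. 0 \<le> (-1) ^ k * (deriv ^^ k) f x) \<and>
     antimono_on {0<..} (\<lambda>x. (-1) ^ (n - 2) * (deriv ^^ (n - 2)) f x) \<and>
     convex_on {0<..} (\<lambda>x. (-1) ^ (n - 2) * (deriv ^^ (n - 2)) f x)"

text \<open>The domain \<open>[0, \<infinity>]\<close> of a generator is \<^typ>\<open>ennreal\<close>.  Continuity there includes
  continuity at \<open>0\<close> and \<open>\<psi> x \<longlongrightarrow> 0\<close> as \<open>x \<longlongrightarrow> \<infinity>\<close>; it is necessary for the function
  \<open>arch_copula n \<psi>\<close> below to have uniform margins.\<close>

definition arch_generator :: "nat \<Rightarrow> (ennreal \<Rightarrow> real) \<Rightarrow> bool" where
  "arch_generator n \<psi> \<longleftrightarrow>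
     continuous_on UNIV \<psi> \<and> (\<forall>x. \<psi> x \<in> {0..1}) \<and> \<psi> 0 = 1 \<and> \<psi> \<infinity> = 0 \<and>
     n_monotone n (\<lambda>x. \<psi> (ennreal x))"

text \<open>The right-continuous inverse of a decreasing function; \<open>gen_inv \<psi> 0\<close> is the least zero
  of a generator \<open>\<psi>\<close>, possibly \<open>\<infinity>\<close>.\<close>

definition gen_inv :: "(ennreal \<Rightarrow> real) \<Rightarrow> real \<Rightarrow> ennreal" where
  "gen_inv \<psi> u = Inf {x. \<psi> x \<le> u}"

definition arch_copula :: "nat \<Rightarrow> (ennreal \<Rightarrow> real) \<Rightarrow> (nat \<Rightarrow> real) \<Rightarrow> real" where
  "arch_copula n \<psi> u = \<psi> (\<Sum>k=1..n. gen_inv \<psi> (u k))"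

definition has_arch_copula ::
  "'a measure \<Rightarrow> nat \<Rightarrow> (nat \<Rightarrow> 'a \<Rightarrow> real) \<Rightarrow> (ennreal \<Rightarrow> real) \<Rightarrow> bool" where
  "has_arch_copula M n X \<psi> \<longleftrightarrow>
     (\<forall>x. measure M {\<omega> \<in> space M. \<forall>k\<in>{1..n}. X k \<omega> \<le> x k}
        = arch_copula n \<psi> (\<lambda>k. dist_fun M (X k) (x k)))"

definition super_additive :: "(ennreal \<Rightarrow> ennreal) \<Rightarrow> bool" where
  "super_additive h \<longleftrightarrow> (\<forall>x y. h (x + y) \<ge> h x + h y)"

text \<open>Positivity is stated separately because \<open>ln 0 = 0\<close> in Isabelle.\<close>

definition log_convex_generator :: "(ennreal \<Rightarrow> real) \<Rightarrow> bool" where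
  "log_convex_generator \<psi> \<longleftrightarrow>
     (\<forall>x\<ge>0. 0 < \<psi> (ennreal x)) \<and> convex_on {0..} (\<lambda>x::real. ln (\<psi> (ennreal x)))"

definition D_plus :: "nat \<Rightarrow> (nat \<Rightarrow> real) set" where
  "D_plus n = {x. antimono_on {1..n} x \<and> (\<forall>i\<in>{1..n}. 0 < x i)}"

definition E_plus :: "nat \<Rightarrow> (nat \<Rightarrow> real) set" where
  "E_plus n = {x. mono_on {1..n} x \<and> (\<forall>i\<in>{1..n}. 0 < x i)}"

text \<open>\<open>incr_arr n x i\<close> is the \<open>i\<close>-th smallest entry, for \<open>i \<in> {1..n}\<close>.\<close>

definition incr_arr :: "nat \<Rightarrow> (nat \<Rightarrow> real) \<Rightarrow> nat \<Rightarrow> real" where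
  "incr_arr n x i = sort (map x [1..<Suc n]) ! (i - 1)"

definition weak_supermaj :: "nat \<Rightarrow> (nat \<Rightarrow> real) \<Rightarrow> (nat \<Rightarrow> real) \<Rightarrow> bool" where
  "weak_supermaj n x y \<longleftrightarrow>
     (\<forall>j\<in>{1..n}. (\<Sum>i=1..j. incr_arr n x i) \<le> (\<Sum>i=1..j. incr_arr n y i))"

end

theory Submission
  imports Defs
begin

text \<open>
  Write \<open>\<phi>\<^sub>i\<close> for the inverse of \<open>\<psi>\<^sub>i\<close>. For \<open>t > l\<close> and \<open>u = t - l\<close> the claim is that
  the copula of \<open>\<psi>1\<close> at the values \<open>F (u / \<sigma>\<^sub>k)\<close> is at most the copula of \<open>\<psi>2\<close> at the
  values \<open>G (u / \<xi>\<^sub>k)\<close>. Three changes lead from the first number to the second, and none of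
  them decreases it.

  \<^item> Replacing \<open>\<psi>1\<close> by \<open>\<psi>2\<close>: super-additivity of \<open>\<phi>\<^sub>2 \<circ> \<psi>1\<close> orders the two copulas
    pointwise (\<open>arch_copula_le_of_super_additive\<close>).
  \<^item> Replacing \<open>F\<close> by \<open>G\<close>: this is \<open>F \<le> G\<close> and monotonicity of a copula in its arguments
    (\<open>arch_copula_mono\<close>).
  \<^item> Replacing \<open>1 / \<sigma>\<close> by \<open>1 / \<xi>\<close>, for one generator \<open>\<psi>\<close> and one baseline \<open>H\<close>
    (\<open>arch_copula_scale_mono\<close>). This step needs a log-convex \<open>\<psi>\<close> and an \<open>H\<close> with decreasing
    reversed hazard rate.

  The first two changes may be made before or after the third. So if \<open>\<psi>\<close> is whichever generator is
  log-convex and \<open>H\<close> whichever baseline has the decreasing reversed hazard rate, one moves to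
  \<open>(\<psi>, H)\<close>, changes the scales there, and then moves on to \<open>(\<psi>2, G)\<close>.

  The change of scales is where the shape conditions enter. The reversed hazard rate is the
  derivative of \<open>ln H\<close> almost everywhere and it decreases, so \<open>ln H\<close> is concave on the
  positive arguments where \<open>H > 0\<close> (\<open>ln_dist_fun_concave\<close>). Log-convexity of \<open>\<psi>\<close> says that its inverse, read
  on a logarithmic scale, is convex and decreasing. Hence \<open>x \<mapsto> \<phi> (H (u x))\<close> is a convex
  decreasing function (\<open>convex_on_gen_inv_comp\<close>). The sum of such
  a function over the entries of a vector can only drop when one passes from a vector to one
  that it weakly supermajorizes (\<open>weak_supermaj_sum_mono\<close>, due to Tomic and Weyl); applying the
  decreasing \<open>\<psi>\<close> reverses the inequality.

  For \<open>t < l\<close> the distribution function of the maximum of the \<open>X\<^sub>k\<close> vanishes, and \<open>t = l\<close>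
  follows from \<open>t > l\<close> by right-continuity.
\<close>

section \<open>Weak supermajorization and convex decreasing functions\<close>

lemma incr_arr_mono:
  assumes "1 \<le> i" "i \<le> j" "j \<le> n"
  shows "incr_arr n x i \<le> incr_arr n x j"
  unfolding incr_arr_def using assms by (intro sorted_nth_mono) auto

lemma incr_arr_in_image:
  assumes "i \<in> {1..n}"
  shows "incr_arr n x i \<in> x ` {1..n}"
proof -
  have "incr_arr n x i \<in> set (sort (map x [1..<Suc n]))"
    unfolding incr_arr_def using assms by (intro nth_mem) auto
  then show ?thesis by (auto simp: atLeastLessThanSuc_atLeastAtMost)
qed

lemma obtain_incr_arr:
  assumes "k \<in> {1..n}"
  obtains i where "i \<in> {1..n}" "x k = incr_arr n x i"
proof -
  have "x k \<in> set (sort (map x [1..<Suc n]))"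
    using assms by (simp add: atLeastLessThanSuc_atLeastAtMost del: upt_Suc)
  then obtain j where "j < n" "sort (map x [1..<Suc n]) ! j = x k"
    by (auto simp: in_set_conv_nth simp del: set_sort upt_Suc)
  then show thesis
    using that[of "Suc j"] by (auto simp: incr_arr_def)
qed

lemma sum_incr_arr:
  fixes h :: "real \<Rightarrow> real"
  shows "(\<Sum>i=1..n. h (incr_arr n x i)) = (\<Sum>i=1..n. h (x i))"
proof -
  have "(\<Sum>i=1..n. h (x i)) = sum_list (map h (map x [1..<Suc n]))"
    by (simp add: interv_sum_list_conv_sum_set_nat atLeastLessThanSuc_atLeastAtMost comp_def
        del: upt_Suc)
  also have "\<dots> = sum_list (map h (sort (map x [1..<Suc n])))"
    unfolding sum_mset_sum_list[symmetric] mset_map mset_sort ..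
  also have "\<dots> = (\<Sum>i=0..<n. h (sort (map x [1..<Suc n]) ! i))"
    by (simp add: sum_list_sum_nth del: upt_Suc)
  also have "\<dots> = (\<Sum>i=1..n. h (incr_arr n x i))"
    unfolding incr_arr_def
    by (rule sum.reindex_bij_witness[of _ "\<lambda>i. i - 1" Suc]) auto
  finally show ?thesis ..
qed

text \<open>The instance \<open>j = 1\<close> of weak supermajorization compares the two minima. It keeps all entries
  of the second vector inside an upward closed set that contains the first vector.\<close>

lemma weak_supermaj_min_le:
  assumes "weak_supermaj n a b" "k \<in> {1..n}"
  obtains j where "j \<in> {1..n}" "a j \<le> b k"
proof -
  have n: "1 \<in> {1..n}" using assms(2) by auto
  obtain i where "i \<in> {1..n}" "b k = incr_arr n b i"
    using assms(2) by (rule obtain_incr_arr)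
  then have "incr_arr n b 1 \<le> b k"
    using incr_arr_mono[of 1 i n b] by auto
  moreover have "incr_arr n a 1 \<le> incr_arr n b 1"
    using assms(1) n unfolding weak_supermaj_def by fastforce
  moreover obtain j where "j \<in> {1..n}" "incr_arr n a 1 = a j"
    using incr_arr_in_image[OF n, of a] by auto
  ultimately show thesis using that[of j] by auto
qed

text \<open>Summation by parts writes the sum as \<open>m\<^sub>n D\<^sub>n + (\<Sum>j<n. (m\<^sub>j - m\<^sub>j\<^sub>+\<^sub>1) D\<^sub>j)\<close>, where \<open>D\<^sub>j\<close> are
  the partial sums of \<open>d\<close>; every term is a product of two nonpositive numbers.\<close>

lemma sum_mult_nonneg_of_partial_sums:
  fixes m d :: "nat \<Rightarrow> real"
  assumes m: "\<And>i. 1 \<le> i \<Longrightarrow> i < n \<Longrightarrow> m i \<le> m (Suc i)"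
    and m0: "\<And>i. 1 \<le> i \<Longrightarrow> i \<le> n \<Longrightarrow> m i \<le> 0"
    and d: "\<And>j. 1 \<le> j \<Longrightarrow> j \<le> n \<Longrightarrow> (\<Sum>i=1..j. d i) \<le> 0"
  shows "0 \<le> (\<Sum>i=1..n. m i * d i)"
proof -
  have "k \<le> n \<Longrightarrow> k \<ge> 1 \<Longrightarrow> m k * (\<Sum>i=1..k. d i) \<le> (\<Sum>i=1..k. m i * d i)" for k
  proof (induction k)
    case (Suc k)
    show ?case
    proof (cases "k = 0")
      case False
      then have IH: "m k * (\<Sum>i=1..k. d i) \<le> (\<Sum>i=1..k. m i * d i)"
        using Suc by auto
      have "m (Suc k) * (\<Sum>i=1..k. d i) \<le> m k * (\<Sum>i=1..k. d i)"
        using False Suc.prems m[of k] d[of k] by (intro mult_right_mono_neg) auto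
      with IH show ?thesis by (simp add: algebra_simps)
    qed simp
  qed simp
  moreover have "0 \<le> m n * (\<Sum>i=1..n. d i)" if "n \<ge> 1"
    using m0[of n] d[of n] that by (intro mult_nonpos_nonpos) auto
  ultimately show ?thesis
    by (cases "n \<ge> 1") (force intro: order_trans, simp)
qed

text \<open>Let \<open>m x\<close> be a subgradient of \<open>h\<close> at \<open>x\<close>. After sorting both vectors, the difference of
  the two sums is at least \<open>\<Sum>i. m (b\<^sub>i) (a\<^sub>i - b\<^sub>i)\<close>. The subgradients increase with \<open>b\<^sub>i\<close> by
  convexity and are nonpositive because \<open>h\<close> decreases, while the partial sums of \<open>a\<^sub>i - b\<^sub>i\<close>
  are nonpositive by weak supermajorization, so summation by parts applies.\<close>

lemma weak_supermaj_sum_mono: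
  fixes h :: "real \<Rightarrow> real"
  assumes maj: "weak_supermaj n a b"
    and S: "open S" and convex: "convex_on S h" and anti: "antimono_on S h"
    and a: "\<And>k. k \<in> {1..n} \<Longrightarrow> a k \<in> S" and b: "\<And>k. k \<in> {1..n} \<Longrightarrow> b k \<in> S"
  shows "(\<Sum>k=1..n. h (b k)) \<le> (\<Sum>k=1..n. h (a k))"
proof -
  define m where "m x = Inf ((\<lambda>t. (h x - h t) / (x - t)) ` ({x<..} \<inter> S))" for x
  have subgrad: "h x + m x * (y - x) \<le> h y" if "x \<in> S" "y \<in> S" for x y
    using convex_le_Inf_differential[OF convex, of x y] that S
    by (simp add: m_def interior_open)
  \<comment> \<open>Add the subgradient inequalities of \<open>x\<close> at \<open>y\<close> and of \<open>y\<close> at \<open>x\<close>.\<close>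
  have m_mono: "m x \<le> m y" if "x \<in> S" "y \<in> S" "x \<le> y" for x y
  proof (cases "x = y")
    case False
    have "m x * (y - x) \<le> m y * (y - x)"
      using subgrad[OF that(1,2)] subgrad[OF that(2,1)] by (simp add: algebra_simps)
    then show ?thesis using that False by (simp add: mult_le_cancel_right)
  qed simp
  have m_nonpos: "m x \<le> 0" if x: "x \<in> S" for x
  proof -
    obtain e where e: "e > 0" "ball x e \<subseteq> S"
      using S x openE by blast
    then have y: "x + e/2 \<in> S" by (auto simp: subset_iff dist_real_def)
    have "h (x + e/2) \<le> h x"
      using anti x y e(1) by (auto simp: monotone_on_def)
    then have "m x * (e/2) \<le> 0" using subgrad[OF x y] by simp
    then show ?thesis using e(1) by (simp add: mult_le_0_iff)
  qed
  let ?a = "incr_arr n a" and ?b = "incr_arr n b"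
  have aS: "?a i \<in> S" and bS: "?b i \<in> S" if "i \<in> {1..n}" for i
    using incr_arr_in_image[OF that, of a] incr_arr_in_image[OF that, of b] a b by auto
  have "0 \<le> (\<Sum>i=1..n. m (?b i) * (?a i - ?b i))"
  proof (rule sum_mult_nonneg_of_partial_sums)
    show "m (?b i) \<le> m (?b (Suc i))" if "1 \<le> i" "i < n" for i
      using that by (intro m_mono bS incr_arr_mono) auto
    show "m (?b i) \<le> 0" if "1 \<le> i" "i \<le> n" for i
      using that by (intro m_nonpos bS) auto
    show "(\<Sum>i=1..j. ?a i - ?b i) \<le> 0" if "1 \<le> j" "j \<le> n" for j
      using maj that by (simp add: sum_subtractf weak_supermaj_def)
  qed
  also have "\<dots> \<le> (\<Sum>i=1..n. h (?a i) - h (?b i))"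
  proof (rule sum_mono)
    fix i assume "i \<in> {1..n}"
    then show "m (?b i) * (?a i - ?b i) \<le> h (?a i) - h (?b i)"
      using subgrad[OF bS aS, of i i] by simp
  qed
  also have "\<dots> = (\<Sum>k=1..n. h (a k)) - (\<Sum>k=1..n. h (b k))"
    by (simp only: sum_subtractf sum_incr_arr)
  finally show ?thesis by simp
qed

section \<open>Archimedean generators and copulas\<close>

text \<open>For \<open>n \<le> 2\<close> the last clause of \<open>n\<close>-monotonicity is about \<open>\<psi>\<close> itself; for \<open>n > 2\<close> the sign of
  the first derivative is used. Both only cover \<open>0 < x < \<infinity>\<close>, and the end points hold
  because \<open>\<psi>\<close> takes its extreme values there.\<close>

lemma arch_generator_antimono:
  assumes gen: "arch_generator n \<psi>" and "x \<le> y"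
  shows "\<psi> y \<le> \<psi> x"
proof -
  let ?p = "\<lambda>x. \<psi> (ennreal x)"
  have mono: "n_monotone n ?p" and range: "\<And>z. \<psi> z \<in> {0..1}"
    and ends: "\<psi> 0 = 1" "\<psi> \<infinity> = 0"
    using gen by (auto simp: arch_generator_def)
  have real: "?p s \<le> ?p r" if "0 < r" "r \<le> s" for r s
  proof (cases "n \<le> 2")
    case True
    then show ?thesis
      using mono that by (auto simp: n_monotone_def monotone_on_def)
  next
    case False
    have diff: "?p field_differentiable at t" if "t > 0" for t
    proof -
      have "(deriv ^^ 0) ?p field_differentiable at t"
        using mono False that unfolding n_monotone_def
        by (metis (no_types, lifting) not_le zero_less_diff)
      then show ?thesis by simp
    qed
    have deriv: "deriv ?p t \<le> 0" if "t > 0" for t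
    proof -
      have "0 \<le> (-1) ^ 1 * (deriv ^^ 1) ?p t"
        using mono False that unfolding n_monotone_def
        by (metis (no_types, lifting) Suc_leI not_le zero_less_diff One_nat_def)
      then show ?thesis by simp
    qed
    show ?thesis
    proof (rule DERIV_nonpos_imp_nonincreasing[OF that(2)])
      fix t assume "r \<le> t" "t \<le> s"
      then have "t > 0" using that by simp
      then show "\<exists>d. (?p has_real_derivative d) (at t) \<and> d \<le> 0"
        using diff deriv DERIV_deriv_iff_field_differentiable by blast
    qed
  qed
  show ?thesis
  proof (cases "x = 0 \<or> y = \<infinity>")
    case True
    then show ?thesis using range[of x] range[of y] ends by auto
  next
    case False
    then obtain s where s: "y = ennreal s" "s \<ge> 0" by (cases y) auto
    moreover obtain r where r: "x = ennreal r" "r \<ge> 0"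
      using False \<open>x \<le> y\<close> s by (cases x) (auto simp: top_unique)
    ultimately show ?thesis
      using real[of r s] False \<open>x \<le> y\<close> by (cases "r = 0") auto
  qed
qed

lemma gen_inv_le: "\<psi> x \<le> u \<Longrightarrow> gen_inv \<psi> u \<le> x"
  unfolding gen_inv_def by (rule Inf_lower) simp

lemma gen_inv_antimono: "u \<le> v \<Longrightarrow> gen_inv \<psi> v \<le> gen_inv \<psi> u"
  unfolding gen_inv_def by (rule Inf_superset_mono) auto

text \<open>Continuity makes \<open>\<psi>\<close> surjective onto the unit interval and makes the infimum in
  \<open>gen_inv\<close> attained, so \<open>gen_inv \<psi>\<close> is a right inverse even where \<open>\<psi>\<close> is not injective.\<close>

lemma generator_gen_inv:
  assumes gen: "arch_generator n \<psi>" and u: "u \<in> {0..1}"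
  shows "\<psi> (gen_inv \<psi> u) = u"
proof -
  have cont: "continuous_on UNIV \<psi>" and ends: "\<psi> 0 = 1" "\<psi> \<infinity> = 0"
    using gen by (auto simp: arch_generator_def)
  have "\<exists>x. 0 \<le> x \<and> x \<le> \<infinity> \<and> \<psi> x = u"
    using u ends by (intro IVT2' continuous_on_subset[OF cont]) auto
  then obtain x where x: "\<psi> x = u" by blast
  have "closed {x. \<psi> x \<le> u}"
    using cont by (intro closed_Collect_le) auto
  then have "gen_inv \<psi> u \<in> {x. \<psi> x \<le> u}"
    unfolding gen_inv_def using x by (intro closed_contains_Inf_cl) auto
  moreover have "u \<le> \<psi> (gen_inv \<psi> u)"
    using arch_generator_antimono[OF gen gen_inv_le[of \<psi> x u]] x by simp
  ultimately show ?thesis by simp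
qed

lemma gen_inv_finite:
  assumes "arch_generator n \<psi>" "0 < u" "u \<le> 1"
  shows "gen_inv \<psi> u < \<infinity>"
proof -
  have "\<psi> \<infinity> = 0" using assms(1) by (simp add: arch_generator_def)
  then have "gen_inv \<psi> u \<noteq> \<infinity>"
    using generator_gen_inv[OF assms(1), of u] assms(2,3) by auto
  then show ?thesis by (simp add: less_top)
qed

lemma arch_copula_mono:
  assumes "arch_generator n \<psi>" "\<And>k. k \<in> {1..n} \<Longrightarrow> u k \<le> v k"
  shows "arch_copula n \<psi> u \<le> arch_copula n \<psi> v"
  unfolding arch_copula_def
  using assms by (intro arch_generator_antimono[OF assms(1)] sum_mono gen_inv_antimono)

lemma arch_copula_le_margin:
  assumes gen: "arch_generator n \<psi>" and "k \<in> {1..n}" "u k \<in> {0..1}"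
  shows "arch_copula n \<psi> u \<le> u k"
proof -
  have "gen_inv \<psi> (u k) \<le> (\<Sum>j=1..n. gen_inv \<psi> (u j))"
    using assms by (intro member_le_sum) auto
  then show ?thesis
    unfolding arch_copula_def
    using arch_generator_antimono[OF gen] generator_gen_inv[OF gen assms(3)] by metis
qed

lemma super_additive_sum:
  assumes "super_additive h" "finite I"
  shows "(\<Sum>k\<in>I. h (x k)) \<le> h (\<Sum>k\<in>I. x k)"
  using assms(2)
proof (induction I rule: finite_induct)
  case (insert i I)
  have "h (x i) + (\<Sum>k\<in>I. h (x k)) \<le> h (x i) + h (\<Sum>k\<in>I. x k)"
    using insert.IH by (rule add_left_mono)
  also have "\<dots> \<le> h (x i + (\<Sum>k\<in>I. x k))"
    using assms(1) by (simp add: super_additive_def)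
  finally show ?case using insert.hyps by simp
qed simp

text \<open>With \<open>x\<^sub>k = \<phi>\<^sub>1 (u\<^sub>k)\<close> super-additivity reads
  \<open>\<Sum>k. \<phi>\<^sub>2 (u\<^sub>k) \<le> \<phi>\<^sub>2 (\<psi>1 (\<Sum>k. x\<^sub>k))\<close>; apply the decreasing function \<open>\<psi>2\<close>.\<close>

lemma arch_copula_le_of_super_additive:
  assumes gen1: "arch_generator n \<psi>1" and gen2: "arch_generator n \<psi>2"
    and sup: "super_additive (gen_inv \<psi>2 \<circ> \<psi>1)"
    and u: "\<And>k. k \<in> {1..n} \<Longrightarrow> u k \<in> {0..1}"
  shows "arch_copula n \<psi>1 u \<le> arch_copula n \<psi>2 u"
proof -
  let ?S = "\<Sum>k=1..n. gen_inv \<psi>1 (u k)"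
  have "(\<Sum>k=1..n. gen_inv \<psi>2 (u k)) = (\<Sum>k=1..n. (gen_inv \<psi>2 \<circ> \<psi>1) (gen_inv \<psi>1 (u k)))"
    using generator_gen_inv[OF gen1 u] by (intro sum.cong) simp_all
  also have "\<dots> \<le> gen_inv \<psi>2 (\<psi>1 ?S)"
    using super_additive_sum[OF sup, of "{1..n}" "\<lambda>k. gen_inv \<psi>1 (u k)"] by simp
  finally have "\<psi>2 (gen_inv \<psi>2 (\<psi>1 ?S)) \<le> \<psi>2 (\<Sum>k=1..n. gen_inv \<psi>2 (u k))"
    by (rule arch_generator_antimono[OF gen2])
  moreover have "\<psi>1 ?S \<in> {0..1}"
    using gen1 by (simp add: arch_generator_def)
  ultimately show ?thesis
    using generator_gen_inv[OF gen2] by (simp add: arch_copula_def)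
qed

text \<open>Since \<open>gen_inv \<psi> v\<close> is the least point where \<open>\<psi>\<close> is at most \<open>v\<close>, convexity of
  \<open>h = gen_inv \<psi> \<circ> F\<close> at \<open>z = p x + q y\<close> only requires \<open>\<psi> (p h x + q h y) \<le> F z\<close>. Both sides
  are compared with the geometric mean \<open>F x\<^sup>p F y\<^sup>q\<close>: the left one by log-convexity of \<open>\<psi>\<close>,
  the right one by log-concavity of \<open>F\<close>.\<close>

lemma convex_on_gen_inv_comp:
  fixes F :: "real \<Rightarrow> real"
  assumes gen: "arch_generator n \<psi>" and logc: "log_convex_generator \<psi>"
    and conc: "concave_on S (\<lambda>x. ln (F x))"
    and F: "\<And>x. x \<in> S \<Longrightarrow> 0 < F x \<and> F x \<le> 1"
  shows "convex_on S (\<lambda>x. enn2real (gen_inv \<psi> (F x)))"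
proof -
  define h where "h x = enn2real (gen_inv \<psi> (F x))" for x
  have h0: "0 \<le> h x" for x by (simp add: h_def)
  have h: "ennreal (h x) = gen_inv \<psi> (F x)" if "x \<in> S" for x
    using gen_inv_finite[OF gen] F[OF that] by (simp add: h_def)
  have \<psi>h: "\<psi> (ennreal (h x)) = F x" if "x \<in> S" for x
    using generator_gen_inv[OF gen, of "F x"] F[OF that] h[OF that] by auto
  have S: "convex S" using conc by (simp add: concave_on_iff)
  have "h (p *\<^sub>R x + q *\<^sub>R y) \<le> p * h x + q * h y"
    if xy: "x \<in> S" "y \<in> S" and pq: "0 \<le> p" "0 \<le> q" "p + q = 1" for x y p q
  proof -
    let ?z = "p *\<^sub>R x + q *\<^sub>R y" and ?w = "p * h x + q * h y"
    have z: "?z \<in> S" using S xy pq by (auto simp: convex_def)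
    have w: "0 \<le> ?w" using h0 pq by simp
    have "ln (\<psi> (ennreal ?w)) \<le> p * ln (\<psi> (ennreal (h x))) + q * ln (\<psi> (ennreal (h y)))"
      using logc h0 pq unfolding log_convex_generator_def convex_on_def by fastforce
    also have "\<dots> = p * ln (F x) + q * ln (F y)"
      using xy by (simp add: \<psi>h)
    also have "\<dots> \<le> ln (F ?z)"
      using conc xy pq by (simp add: concave_on_iff)
    finally have "\<psi> (ennreal ?w) \<le> F ?z"
      using logc w F[OF z] by (simp add: log_convex_generator_def)
    then have "ennreal (h ?z) \<le> ennreal ?w"
      unfolding h[OF z] by (rule gen_inv_le)
    then show ?thesis using w by simp
  qed
  then show ?thesis unfolding convex_on_def h_def[symmetric] using S by blast
qed

text \<open>If some \<open>F (u a\<^sub>k)\<close> vanishes, so does the left-hand copula. Otherwise all points \<open>u a\<^sub>k\<close> and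
  \<open>u b\<^sub>k\<close> lie where \<open>F > 0\<close>; there \<open>x \<mapsto> gen_inv \<psi> (F (u x))\<close> is finite, convex and
  decreasing.\<close>

lemma arch_copula_scale_mono:
  fixes F :: "real \<Rightarrow> real"
  assumes gen: "arch_generator n \<psi>" and logc: "log_convex_generator \<psi>"
    and monoF: "mono F" and contF: "continuous_on UNIV F" and F01: "\<And>x. F x \<in> {0..1}"
    and conc: "concave_on {x. 0 < x \<and> 0 < F x} (\<lambda>x. ln (F x))"
    and u: "0 < u" and a: "\<And>k. k \<in> {1..n} \<Longrightarrow> 0 < a k" and b: "\<And>k. k \<in> {1..n} \<Longrightarrow> 0 < b k"
    and maj: "weak_supermaj n a b"
  shows "arch_copula n \<psi> (\<lambda>k. F (u * a k)) \<le> arch_copula n \<psi> (\<lambda>k. F (u * b k))"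
proof (cases "\<exists>k\<in>{1..n}. F (u * a k) = 0")
  case True
  then obtain k where k: "k \<in> {1..n}" "F (u * a k) = 0" by blast
  have "arch_copula n \<psi> (\<lambda>k. F (u * a k)) \<le> 0"
    using arch_copula_le_margin[OF gen k(1), of "\<lambda>k. F (u * a k)"] F01 k(2) by simp
  also have "0 \<le> arch_copula n \<psi> (\<lambda>k. F (u * b k))"
    using gen by (simp add: arch_copula_def arch_generator_def)
  finally show ?thesis .
next
  case False
  define S where "S = {x. 0 < x \<and> 0 < F (u * x)}"
  define h where "h x = enn2real (gen_inv \<psi> (F (u * x)))" for x
  have aS: "a k \<in> S" if "k \<in> {1..n}" for k
    using False a that F01[of "u * a k"] by (auto simp: S_def order.order_iff_strict)
  have bS: "b k \<in> S" if k: "k \<in> {1..n}" for k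
  proof -
    obtain j where j: "j \<in> {1..n}" "a j \<le> b k"
      using maj k by (rule weak_supermaj_min_le)
    then have "F (u * a j) \<le> F (u * b k)"
      using u by (intro monoD[OF monoF]) simp
    then show ?thesis using aS[OF j(1)] b[OF k] by (auto simp: S_def)
  qed
  have h: "gen_inv \<psi> (F (u * x)) = ennreal (h x)" if "x \<in> S" for x
    using gen_inv_finite[OF gen] F01[of "u * x"] that by (simp add: h_def S_def)
  have "open S"
    unfolding S_def
    by (intro open_Collect_conj open_Collect_less continuous_intros
        continuous_on_compose2[OF contF]) auto
  moreover have "convex_on S h"
  proof -
    have "concave_on S (\<lambda>x. ln (F (u * x)))"
      unfolding concave_on_iff
    proof (intro conjI ballI allI impI)
      have eq: "u * (p *\<^sub>R x + q *\<^sub>R y) = p *\<^sub>R (u * x) + q *\<^sub>R (u * y)" for p q x y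
        by (simp add: algebra_simps)
      have "S = {x. u * x \<in> {x. 0 < x \<and> 0 < F x}}"
        using u by (auto simp: S_def zero_less_mult_iff)
      moreover have "convex {x. 0 < x \<and> 0 < F x}"
        using conc by (simp add: concave_on_iff)
      ultimately show "convex S"
        unfolding convex_def by (simp only: mem_Collect_eq eq) blast
      fix x y p q :: real
      assume *: "x \<in> S" "y \<in> S" "0 \<le> p" "0 \<le> q" "p + q = 1"
      then show "p * ln (F (u * x)) + q * ln (F (u * y)) \<le> ln (F (u * (p *\<^sub>R x + q *\<^sub>R y)))"
        using conc u unfolding concave_on_iff eq S_def by simp
    qed
    then show ?thesis
      unfolding h_def using F01 by (intro convex_on_gen_inv_comp[OF gen logc]) (auto simp: S_def)
  qed
  moreover have "antimono_on S h"
  proof (rule monotone_onI)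
    fix x y assume xy: "x \<in> S" "y \<in> S" "x \<le> y"
    then have "ennreal (h y) \<le> ennreal (h x)"
      unfolding h[OF xy(1), symmetric] h[OF xy(2), symmetric] using u
      by (intro gen_inv_antimono monoD[OF monoF]) simp
    then show "h y \<le> h x" by (simp add: h_def)
  qed
  ultimately have sum_le: "(\<Sum>k=1..n. h (b k)) \<le> (\<Sum>k=1..n. h (a k))"
    using maj aS bS by (intro weak_supermaj_sum_mono)
  have copula: "arch_copula n \<psi> (\<lambda>k. F (u * c k)) = \<psi> (ennreal (\<Sum>k=1..n. h (c k)))"
    if "\<And>k. k \<in> {1..n} \<Longrightarrow> c k \<in> S" for c
  proof -
    have "(\<Sum>k=1..n. gen_inv \<psi> (F (u * c k))) = (\<Sum>k=1..n. ennreal (h (c k)))"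
      using h that by (intro sum.cong) auto
    also have "\<dots> = ennreal (\<Sum>k=1..n. h (c k))"
      by (rule sum_ennreal) (simp add: h_def)
    finally show ?thesis by (simp only: arch_copula_def)
  qed
  have "arch_copula n \<psi> (\<lambda>k. F (u * a k)) = \<psi> (ennreal (\<Sum>k=1..n. h (a k)))"
    using aS by (rule copula)
  also have "\<dots> \<le> \<psi> (ennreal (\<Sum>k=1..n. h (b k)))"
    by (rule arch_generator_antimono[OF gen ennreal_leI[OF sum_le]])
  also have "\<dots> = arch_copula n \<psi> (\<lambda>k. F (u * b k))"
    using bS by (rule copula[symmetric])
  finally show ?thesis .
qed

section \<open>Log-concavity from a decreasing reversed hazard rate\<close>

text \<open>A Gronwall inequality for functions that need not be differentiable: a distribution function
  with a density need only be differentiable almost everywhere. Over \<open>N\<close> equal steps the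
  hypothesis gives \<open>K z (1 - c (z - y) / N)\<^sup>N \<le> K y\<close>; let \<open>N\<close> tend to infinity. The constant
  \<open>c\<close> may be negative, which also yields lower bounds for growing functions by reflection.\<close>

lemma discrete_gronwall:
  fixes K :: "real \<Rightarrow> real"
  assumes "y \<le> z"
    and step: "\<And>s t. y \<le> s \<Longrightarrow> s \<le> t \<Longrightarrow> t \<le> z \<Longrightarrow> K t - K s \<le> c * (t - s) * K t"
  shows "K z \<le> K y * exp (c * (z - y))"
proof -
  let ?x = "- (c * (z - y))"
  have "eventually (\<lambda>N. \<bar>?x\<bar> < real N) sequentially"
    using filterlim_real_sequentially by (simp add: filterlim_at_top_dense)
  \<comment> \<open>For such \<open>N\<close> the factor \<open>1 + ?x / N\<close> is nonnegative, so the steps can be chained.\<close>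
  then have "eventually (\<lambda>N. K z * (1 + ?x / real N) ^ N \<le> K y) sequentially"
  proof eventually_elim
    case (elim N)
    then have N: "real N > 0" by linarith
    define p where "p k = y + real k * ((z - y) / real N)" for k
    define q where "q = 1 + ?x / real N"
    have q: "0 \<le> q"
      using elim N by (simp add: q_def field_simps)
    have "k \<le> N \<Longrightarrow> K (p k) * q ^ k \<le> K y" for k
    proof (induction k)
      case (Suc k)
      define e where "e = (z - y) / real N"
      have e: "0 \<le> e" "real N * e = z - y"
        using \<open>y \<le> z\<close> N by (auto simp: e_def)
      have p_e: "p j = y + real j * e" for j
        by (simp add: p_def e_def)
      have p_Suc: "p (Suc k) - p k = e"
        by (simp add: p_e algebra_simps)
      have "real (Suc k) * e \<le> real N * e"
        using Suc.prems e by (intro mult_right_mono) auto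
      then have "y \<le> p k" "p k \<le> p (Suc k)" "p (Suc k) \<le> z"
        using p_Suc e by (auto simp: p_e)
      then have "K (p (Suc k)) - K (p k) \<le> c * (p (Suc k) - p k) * K (p (Suc k))"
        by (rule step)
      moreover have "q = 1 - c * e"
        by (simp add: q_def e_def)
      ultimately have "K (p (Suc k)) * q \<le> K (p k)"
        by (simp add: p_Suc right_diff_distrib mult_ac)
      then have "K (p (Suc k)) * q * q ^ k \<le> K (p k) * q ^ k"
        using q by (intro mult_right_mono) auto
      then show ?case using Suc by (simp add: mult.assoc)
    qed (simp add: p_def)
    from this[of N] show ?case using N by (simp add: p_def q_def)
  qed
  moreover have "(\<lambda>N. K z * (1 + ?x / real N) ^ N) \<longlonglongrightarrow> K z * exp ?x"
    by (intro tendsto_intros tendsto_exp_limit_sequentially)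
  ultimately have "K z * exp ?x \<le> K y"
    by (intro tendsto_upperbound) auto
  then have "K z / exp (c * (z - y)) \<le> K y"
    by (simp only: exp_minus divide_inverse)
  then show ?thesis by (simp add: pos_divide_le_eq)
qed

context prob_space
begin

lemma dist_fun_in_unit:
  assumes "U \<in> borel_measurable M"
  shows "dist_fun M U x \<in> {0..1}"
proof -
  interpret D: prob_space "distr M borel U" using assms by (rule prob_space_distr)
  show ?thesis by (simp add: dist_fun_def cdf_def)
qed

lemma mono_dist_fun:
  assumes "U \<in> borel_measurable M"
  shows "mono (dist_fun M U)"
proof -
  interpret D: real_distribution "distr M borel U" using assms by (rule real_distribution_distr)
  show ?thesis unfolding dist_fun_def by (intro monoI D.cdf_nondecreasing)
qed

lemma tendsto_dist_fun_at_right: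
  assumes "U \<in> borel_measurable M"
  shows "(dist_fun M U \<longlongrightarrow> dist_fun M U x) (at_right x)"
proof -
  interpret D: real_distribution "distr M borel U" using assms by (rule real_distribution_distr)
  show ?thesis unfolding dist_fun_def using D.cdf_is_right_cont by (simp add: continuous_within)
qed

lemma emeasure_distr_density:
  assumes "distributed M lborel U f" "B \<in> sets borel"
  shows "emeasure (distr M borel U) B = (\<integral>\<^sup>+x. f x * indicator B x \<partial>lborel)"
proof -
  have "distr M borel U = distr M lborel U" by (rule distr_cong) simp_all
  then show ?thesis
    using assms distributed_distr_eq_density[OF assms(1)] distributed_borel_measurable[OF assms(1)]
    by (simp add: emeasure_density)
qed

lemma continuous_dist_fun:
  assumes dist: "distributed M lborel U f"
  shows "continuous_on UNIV (dist_fun M U)"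
proof -
  have "U \<in> borel_measurable M" using distributed_measurable[OF dist] by simp
  then interpret D: real_distribution "distr M borel U" by (rule real_distribution_distr)
  have "emeasure (distr M borel U) {x} = 0" for x
    using dist AE_lborel_singleton[of x]
    by (subst emeasure_distr_density[OF dist])
       (auto simp: nn_integral_0_iff_AE distributed_borel_measurable elim!: AE_mp split: split_indicator)
  then show ?thesis
    unfolding dist_fun_def continuous_on_eq_continuous_at[OF open_UNIV]
    using D.isCont_cdf by (simp add: measure_def)
qed

lemma
  assumes dist: "distributed M lborel U (\<lambda>x. ennreal (f x))" and "s \<le> t" "0 \<le> c"
  shows dist_fun_diff_le:
      "(\<And>x. s < x \<Longrightarrow> x \<le> t \<Longrightarrow> f x \<le> c) \<Longrightarrow> dist_fun M U t - dist_fun M U s \<le> c * (t - s)"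
    and dist_fun_diff_ge:
      "(\<And>x. s < x \<Longrightarrow> x \<le> t \<Longrightarrow> c \<le> f x) \<Longrightarrow> c * (t - s) \<le> dist_fun M U t - dist_fun M U s"
proof -
  have "U \<in> borel_measurable M" using distributed_measurable[OF dist] by simp
  then interpret D: real_distribution "distr M borel U" by (rule real_distribution_distr)
  have "ennreal (dist_fun M U t - dist_fun M U s) = emeasure (distr M borel U) {s<..t}"
    using \<open>s \<le> t\<close> D.cdf_diff_eq[of s t]
    by (cases "s = t") (auto simp: dist_fun_def D.emeasure_eq_measure)
  then have diff: "ennreal (dist_fun M U t - dist_fun M U s)
      = (\<integral>\<^sup>+x. ennreal (f x) * indicator {s<..t} x \<partial>lborel)"
    by (simp add: emeasure_distr_density[OF dist])
  have const: "(\<integral>\<^sup>+x. ennreal c * indicator {s<..t} x \<partial>lborel) = ennreal (c * (t - s))"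
    using assms by (simp add: nn_integral_cmult_indicator ennreal_mult)
  have nonneg: "0 \<le> dist_fun M U t - dist_fun M U s"
    using D.cdf_nondecreasing[OF \<open>s \<le> t\<close>] by (simp add: dist_fun_def)
  show "dist_fun M U t - dist_fun M U s \<le> c * (t - s)"
    if "\<And>x. s < x \<Longrightarrow> x \<le> t \<Longrightarrow> f x \<le> c"
  proof -
    have "ennreal (dist_fun M U t - dist_fun M U s) \<le> ennreal (c * (t - s))"
      unfolding diff const[symmetric] using that
      by (intro nn_integral_mono) (auto split: split_indicator intro: ennreal_leI)
    then show ?thesis using assms by simp
  qed
  show "c * (t - s) \<le> dist_fun M U t - dist_fun M U s"
    if "\<And>x. s < x \<Longrightarrow> x \<le> t \<Longrightarrow> c \<le> f x"
  proof -
    have "ennreal (c * (t - s)) \<le> ennreal (dist_fun M U t - dist_fun M U s)"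
      unfolding diff const[symmetric] using that
      by (intro nn_integral_mono) (auto split: split_indicator intro: ennreal_leI)
    then show ?thesis using nonneg by simp
  qed
qed

text \<open>The value \<open>c\<close> of the reversed hazard rate at \<open>y\<close> is a supergradient of \<open>ln F\<close> at \<open>y\<close>: to the
  right of \<open>y\<close> the density is at most \<open>c F\<close>, to the left of \<open>y\<close> it is at least \<open>c F\<close>, and
  Gronwall's inequality turns these bounds into \<open>F z \<le> F y * exp (c * (z - y))\<close> on both
  sides. A function with a supergradient at every point is concave.\<close>

lemma ln_dist_fun_concave:
  assumes f0: "\<And>x. 0 \<le> f x" and dist: "distributed M lborel U (\<lambda>x. ennreal (f x))"
    and F_def: "F = dist_fun M U" and decr: "decreasing_rev_hazard f F"
  shows "concave_on {x. 0 < x \<and> 0 < F x} (\<lambda>x. ln (F x))"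
proof -
  define S where "S = {x. 0 < x \<and> 0 < F x}"
  have monoF: "mono F" and F0: "0 \<le> F x" for x
    using mono_dist_fun dist_fun_in_unit distributed_measurable[OF dist] by (auto simp: F_def)
  have up: "t \<in> S" if "s \<in> S" "s \<le> t" for s t
    using that monoD[OF monoF, of s t] by (auto simp: S_def)
  have f: "f x = rev_hazard f F x * F x" if "x \<in> S" for x
    using that by (simp add: rev_hazard_def S_def)
  have r: "rev_hazard f F t \<le> rev_hazard f F s" if "s \<in> S" "s \<le> t" for s t
    using decr that up[OF that] by (auto simp: decreasing_rev_hazard_def S_def monotone_on_def)
  have supergrad: "ln (F z) \<le> ln (F y) + rev_hazard f F y * (z - y)"
    if y: "y \<in> S" and z: "z \<in> S" for y z
  proof -
    define c where "c = rev_hazard f F y"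
    have c: "0 \<le> c" using f0 F0 by (simp add: c_def rev_hazard_def)
    have "F z \<le> F y * exp (c * (z - y))"
    proof (cases "y \<le> z")
      case True
      then show ?thesis
      proof (rule discrete_gronwall)
        fix s t assume st: "y \<le> s" "s \<le> t" "t \<le> z"
        have "f x \<le> c * F t" if "s < x" "x \<le> t" for x
        proof -
          have "x \<in> S" using up[OF y] that st by simp
          then show ?thesis
            using f r[OF y, of x] monoD[OF monoF that(2)] that st F0 c
            by (auto simp: c_def intro!: mult_mono)
        qed
        then have "F t - F s \<le> (c * F t) * (t - s)"
          unfolding F_def using c F0 st
          by (intro dist_fun_diff_le[OF dist]) (auto simp: F_def)
        then show "F t - F s \<le> c * (t - s) * F t" by (simp add: mult_ac)
      qed
    next
      case False
      \<comment> \<open>Reflection turns the lower bound on the increments into an upper bound with rate \<open>- c\<close>.\<close>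
      have "F (- (- z)) \<le> F (- (- y)) * exp ((- c) * ((- z) - (- y)))"
      proof (rule discrete_gronwall[where K = "\<lambda>x. F (- x)"])
        fix s t assume st: "- y \<le> s" "s \<le> t" "t \<le> - z"
        have "c * F (- t) \<le> f x" if "- t < x" "x \<le> - s" for x
        proof -
          have x: "x \<in> S" using up[OF z] that st by simp
          then show ?thesis
            using f r[OF x, of y] monoD[OF monoF, of "- t" x] that st F0 c
            by (auto simp: c_def intro!: mult_mono)
        qed
        then have "(c * F (- t)) * (- s - - t) \<le> F (- s) - F (- t)"
          unfolding F_def using c F0 st
          by (intro dist_fun_diff_ge[OF dist]) (auto simp: F_def)
        then show "F (- t) - F (- s) \<le> (- c) * (t - s) * F (- t)"
          by (simp add: algebra_simps)
      qed (use False in simp)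
      then show ?thesis by (simp add: algebra_simps)
    qed
    then have "ln (F z) \<le> ln (F y * exp (c * (z - y)))"
      using z by (subst ln_le_cancel_iff) (auto simp: S_def intro: less_le_trans)
    also have "\<dots> = ln (F y) + c * (z - y)"
      using y by (simp add: ln_mult S_def)
    finally show ?thesis by (simp add: c_def)
  qed
  have conv: "convex S"
  proof (rule convexI)
    fix x y p q :: real assume *: "x \<in> S" "y \<in> S" "0 \<le> p" "0 \<le> q" "p + q = 1"
    have "min x y \<in> S" using * by (simp add: min_def)
    moreover have "p * min x y + q * min x y \<le> p * x + q * y"
      using * by (intro add_mono mult_left_mono) auto
    moreover have "p * min x y + q * min x y = min x y"
      using *(5) by (metis distrib_right mult_1)
    ultimately show "p *\<^sub>R x + q *\<^sub>R y \<in> S"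
      using up by simp
  qed
  show ?thesis
    unfolding concave_on_iff S_def[symmetric]
  proof (intro conjI ballI allI impI conv)
    fix x y p q :: real assume *: "x \<in> S" "y \<in> S" "0 \<le> p" "0 \<le> q" "p + q = 1"
    let ?z = "p *\<^sub>R x + q *\<^sub>R y"
    have z: "?z \<in> S" using conv * by (auto simp: convex_def)
    let ?c = "rev_hazard f F ?z"
    have "p * ln (F x) + q * ln (F y)
        \<le> p * (ln (F ?z) + ?c * (x - ?z)) + q * (ln (F ?z) + ?c * (y - ?z))"
      using * z by (intro add_mono mult_left_mono supergrad)
    also have "\<dots> = (p + q) * ln (F ?z) + ?c * (?z - (p + q) * ?z)"
      by (simp add: algebra_simps)
    also have "\<dots> = ln (F ?z)" using *(5) by simp
    finally show "p * ln (F x) + q * ln (F y) \<le> ln (F ?z)" .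
  qed
qed

section \<open>The distribution of the maximum\<close>

lemma borel_measurable_max_order_stat:
  assumes "\<And>i. i \<in> {1..n} \<Longrightarrow> Xs i \<in> borel_measurable M"
  shows "max_order_stat n Xs \<in> borel_measurable M"
proof -
  have "(\<lambda>\<omega>. Max ((\<lambda>i. Xs i \<omega>) ` {1..n})) \<in> borel_measurable M"
    using assms by (intro borel_measurable_Max) auto
  then show ?thesis by (simp add: max_order_stat_def[abs_def])
qed

lemma dist_fun_max_order_stat:
  assumes n: "1 \<le> n" and meas: "\<And>i. i \<in> {1..n} \<Longrightarrow> Xs i \<in> borel_measurable M"
    and cop: "has_arch_copula M n Xs \<psi>"
  shows "dist_fun M (max_order_stat n Xs) t = arch_copula n \<psi> (\<lambda>k. dist_fun M (Xs k) t)"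
proof -
  have "dist_fun M (max_order_stat n Xs) t
      = measure M (max_order_stat n Xs -` {..t} \<inter> space M)"
    using borel_measurable_max_order_stat[OF meas] by (simp add: dist_fun_def cdf_def measure_distr)
  also have "max_order_stat n Xs -` {..t} \<inter> space M
      = {\<omega> \<in> space M. \<forall>k\<in>{1..n}. Xs k \<omega> \<le> t}"
    using n by (auto simp: max_order_stat_def)
  also have "measure M \<dots> = arch_copula n \<psi> (\<lambda>k. dist_fun M (Xs k) t)"
    using cop by (auto simp: has_arch_copula_def)
  finally show ?thesis .
qed

lemma dist_fun_max_loc_scale:
  assumes n: "1 \<le> n" and ls: "\<And>i. i \<in> {1..n} \<Longrightarrow> loc_scale M l (\<sigma> i) F (Xs i)"
    and cop: "has_arch_copula M n Xs \<psi>" and t: "l < t"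
  shows "dist_fun M (max_order_stat n Xs) t = arch_copula n \<psi> (\<lambda>k. F ((t - l) * (1 / \<sigma> k)))"
proof -
  have "dist_fun M (max_order_stat n Xs) t = arch_copula n \<psi> (\<lambda>k. dist_fun M (Xs k) t)"
    using ls by (intro dist_fun_max_order_stat n cop) (auto simp: loc_scale_def)
  also have "\<dots> = arch_copula n \<psi> (\<lambda>k. F ((t - l) * (1 / \<sigma> k)))"
    using ls t unfolding arch_copula_def by (auto simp: loc_scale_def intro!: arg_cong[of _ _ \<psi>] sum.cong)
  finally show ?thesis .
qed

lemma dist_fun_max_below_location:
  assumes n: "1 \<le> n" and ls: "\<And>i. i \<in> {1..n} \<Longrightarrow> loc_scale M l (\<sigma> i) F (Xs i)"
    and gen: "arch_generator n \<psi>" and cop: "has_arch_copula M n Xs \<psi>" and t: "t < l"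
  shows "dist_fun M (max_order_stat n Xs) t \<le> 0"
proof -
  have "dist_fun M (Xs 1) t = 0" using ls[of 1] n t by (auto simp: loc_scale_def)
  then have "arch_copula n \<psi> (\<lambda>k. dist_fun M (Xs k) t) \<le> 0"
    using arch_copula_le_margin[OF gen, of 1 "\<lambda>k. dist_fun M (Xs k) t"] n by simp
  moreover have "dist_fun M (max_order_stat n Xs) t = arch_copula n \<psi> (\<lambda>k. dist_fun M (Xs k) t)"
    using ls by (intro dist_fun_max_order_stat n cop) (auto simp: loc_scale_def)
  ultimately show ?thesis by simp
qed

end

section \<open>Comparison of the maxima\<close>

theorem theorem16:
  fixes n :: nat
    and A :: "'a measure" and X :: "'a \<Rightarrow> real" and f F :: "real \<Rightarrow> real"
    and B :: "'b measure" and Y :: "'b \<Rightarrow> real" and g G :: "real \<Rightarrow> real"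
    and M :: "'c measure" and Xs :: "nat \<Rightarrow> 'c \<Rightarrow> real"
    and N :: "'d measure" and Ys :: "nat \<Rightarrow> 'd \<Rightarrow> real"
    and \<psi>1 \<psi>2 :: "ennreal \<Rightarrow> real"
    and l :: real and \<sigma> \<xi> :: "nat \<Rightarrow> real"
  assumes n: "n \<ge> 1"
    and "prob_space A" and "\<forall>x. 0 \<le> f x" and "distributed A lborel X (\<lambda>x. ennreal (f x))"
    and "F = dist_fun A X"
    and "prob_space B" and "\<forall>x. 0 \<le> g x" and "distributed B lborel Y (\<lambda>x. ennreal (g x))"
    and "G = dist_fun B Y"
    and "prob_space M" and "\<forall>i\<in>{1..n}. loc_scale M l (\<sigma> i) F (Xs i)"
    and "arch_generator n \<psi>1" and "has_arch_copula M n Xs \<psi>1"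
    and "prob_space N" and "\<forall>i\<in>{1..n}. loc_scale N l (\<xi> i) G (Ys i)"
    and "arch_generator n \<psi>2" and "has_arch_copula N n Ys \<psi>2"
    and "((\<lambda>_. l) \<in> D_plus n \<and> \<sigma> \<in> D_plus n \<and> \<xi> \<in> D_plus n) \<or>
         ((\<lambda>_. l) \<in> E_plus n \<and> \<sigma> \<in> E_plus n \<and> \<xi> \<in> E_plus n)"
    and "super_additive (gen_inv \<psi>2 \<circ> \<psi>1)"
    and "log_convex_generator \<psi>1 \<or> log_convex_generator \<psi>2"
    and "st_ge A X B Y"
    and "decreasing_rev_hazard f F \<or> decreasing_rev_hazard g G"
    and "weak_supermaj n (\<lambda>i. 1 / \<sigma> i) (\<lambda>i. 1 / \<xi> i)"
  shows "st_ge M (max_order_stat n Xs) N (max_order_stat n Ys)"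
proof -
  interpret A: prob_space A by fact
  interpret B: prob_space B by fact
  interpret M: prob_space M by fact
  interpret N: prob_space N by fact
  have f0: "\<And>x. 0 \<le> f x" and g0: "\<And>x. 0 \<le> g x"
    and lsX: "\<And>i. i \<in> {1..n} \<Longrightarrow> loc_scale M l (\<sigma> i) F (Xs i)"
    and lsY: "\<And>i. i \<in> {1..n} \<Longrightarrow> loc_scale N l (\<xi> i) G (Ys i)"
    using assms(3,7,11,15) by auto
  note distX = assms(4) and F = assms(5) and distY = assms(8) and G = assms(9)
    and gen1 = assms(12) and copX = assms(13) and gen2 = assms(16) and copY = assms(17)
    and super = assms(19) and maj = assms(23)
  have measX: "X \<in> borel_measurable A" and measY: "Y \<in> borel_measurable B"
    using distributed_measurable[OF distX] distributed_measurable[OF distY] by auto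
  have F01: "F x \<in> {0..1}" and G01: "G x \<in> {0..1}" for x
    unfolding F G by (intro A.dist_fun_in_unit B.dist_fun_in_unit measX measY)+
  have monoF: "mono F" and monoG: "mono G"
    unfolding F G by (intro A.mono_dist_fun B.mono_dist_fun measX measY)+
  have contF: "continuous_on UNIV F" and contG: "continuous_on UNIV G"
    unfolding F G by (rule A.continuous_dist_fun[OF distX] B.continuous_dist_fun[OF distY])+
  have FG: "F x \<le> G x" for x
    using assms(21) by (simp add: st_ge_def F G)
  obtain \<psi> where \<psi>: "\<psi> = \<psi>1 \<or> \<psi> = \<psi>2" "log_convex_generator \<psi>"
    using assms(20) by blast
  then have gen: "arch_generator n \<psi>" using gen1 gen2 by blast
  obtain H where H: "H = F \<or> H = G"
    and conc: "concave_on {x. 0 < x \<and> 0 < H x} (\<lambda>x. ln (H x))"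
    using assms(22) A.ln_dist_fun_concave[OF f0 distX F] B.ln_dist_fun_concave[OF g0 distY G]
    by blast
  have FH: "F x \<le> H x" and HG: "H x \<le> G x" and H01: "H x \<in> {0..1}" for x
    using H FG F01 G01 by auto
  have monoH: "mono H" and contH: "continuous_on UNIV H"
    using H monoF monoG contF contG by auto
  have cop1: "arch_copula n \<psi>1 u \<le> arch_copula n \<psi> u"
    and cop2: "arch_copula n \<psi> u \<le> arch_copula n \<psi>2 u"
    if "\<And>k. u k \<in> {0..1}" for u
    using \<psi>(1) arch_copula_le_of_super_additive[OF gen1 gen2 super that] by auto
  let ?P = "dist_fun M (max_order_stat n Xs)" and ?Q = "dist_fun N (max_order_stat n Ys)"
  have measP: "max_order_stat n Xs \<in> borel_measurable M"
    using lsX by (intro M.borel_measurable_max_order_stat) (auto simp: loc_scale_def)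
  have measQ: "max_order_stat n Ys \<in> borel_measurable N"
    using lsY by (intro N.borel_measurable_max_order_stat) (auto simp: loc_scale_def)
  have above: "?P t \<le> ?Q t" if t: "l < t" for t
  proof -
    let ?a = "\<lambda>k. (t - l) * (1 / \<sigma> k)" and ?b = "\<lambda>k. (t - l) * (1 / \<xi> k)"
    have "?P t = arch_copula n \<psi>1 (\<lambda>k. F (?a k))"
      by (rule M.dist_fun_max_loc_scale[OF n lsX copX t])
    also have "\<dots> \<le> arch_copula n \<psi> (\<lambda>k. F (?a k))"
      by (rule cop1) (rule F01)
    also have "\<dots> \<le> arch_copula n \<psi> (\<lambda>k. H (?a k))"
      by (rule arch_copula_mono[OF gen]) (rule FH)
    also have "\<dots> \<le> arch_copula n \<psi> (\<lambda>k. H (?b k))"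
      using lsX lsY t maj
      by (intro arch_copula_scale_mono[OF gen \<psi>(2) monoH contH H01 conc])
         (auto simp: loc_scale_def)
    also have "\<dots> \<le> arch_copula n \<psi> (\<lambda>k. G (?b k))"
      by (rule arch_copula_mono[OF gen]) (rule HG)
    also have "\<dots> \<le> arch_copula n \<psi>2 (\<lambda>k. G (?b k))"
      by (rule cop2) (rule G01)
    also have "\<dots> = ?Q t"
      by (rule N.dist_fun_max_loc_scale[OF n lsY copY t, symmetric])
    finally show ?thesis .
  qed
  have "?P t \<le> ?Q t" for t
  proof (cases l t rule: linorder_cases)
    case less
    then show ?thesis by (rule above)
  next
    case equal
    have "?P l \<le> ?Q l"
    proof (rule tendsto_le)
      show "(?P \<longlongrightarrow> ?P l) (at_right l)" "(?Q \<longlongrightarrow> ?Q l) (at_right l)"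
        by (intro M.tendsto_dist_fun_at_right N.tendsto_dist_fun_at_right measP measQ)+
      show "eventually (\<lambda>t. ?P t \<le> ?Q t) (at_right l)"
        using above by (auto simp: eventually_at_filter)
    qed simp
    then show ?thesis using equal by simp
  next
    case greater
    have "?P t \<le> 0" by (rule M.dist_fun_max_below_location[OF n lsX gen1 copX greater])
    also have "0 \<le> ?Q t" using N.dist_fun_in_unit[OF measQ] by simp
    finally show ?thesis .
  qed
  then show ?thesis by (simp add: st_ge_def)
qed

end
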